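(* Let $X_G$ be the shift space generated by a two-dimensional graph $G=(H,V)$, where neither adjacency matrix $H$ nor $V$ has a zero row or a zero column. If for all indices $i,j$ one has $(HV)_{ij}\neq 0 \Rightarrow (VH)_{ij}\neq 0$, then $X_G\neq\emptyset$.
   Context: A two-dimensional graph is a pair $G=(H,V)$ of directed graphs (at most one edge for each ordered pair of vertices, loops allowed) on a common finite nonempty vertex set $\mathcal{V}$; $H$ and $V$ also denote their $0$-$1$ adjacency matrices indexed by $\mathcal{V}$. The shift space generated by $G$ is $$X_G=\{x\in\mathcal{V}^{\mathbb{Z}^2}: H_{x(i,j),x(i+1,j)}=1 \text{ and } V_{x(i,j),x(i,j+1)}=1 \text{ for all } (i,j)\in\mathbb{Z}^2\}.$$ *)

theory Defs
  imports "HOL-Analysis.Analysis"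
begin

text \<open>
  The finite nonempty vertex set is the universe of a type of class \<open>finite\<close>.
  A directed graph with loops allowed and at most one edge per ordered pair of vertices
  is a set of ordered pairs.
\<close>

type_synonym 'v two_dim_graph = "'v rel \<times> 'v rel"

definition adjacency_matrix :: "'v::finite rel \<Rightarrow> int ^ 'v ^ 'v" where
  "adjacency_matrix E = (\<chi> i j. if (i, j) \<in> E then 1 else 0)"

definition shift_space :: "'v::finite two_dim_graph \<Rightarrow> (int \<times> int \<Rightarrow> 'v) set" where
  "shift_space G = {x. \<forall>i j.
     adjacency_matrix (fst G) $ x (i, j) $ x (i + 1, j) = 1 \<and>
     adjacency_matrix (snd G) $ x (i, j) $ x (i, j + 1) = 1}"

end

theory Submission
  imports Defs
begin

text \<open>
  In terms of relations the hypothesis on the products says that every path consisting of an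
  \<open>H\<close>-edge followed by a \<open>V\<close>-edge can be completed to a square: a bottom edge and a right edge
  always admit a matching top-left corner. A quadrant opening to the left and upwards can thus be
  filled: the bottom row is continued to the left because \<open>H\<close> has no zero column, the right-hand
  column is continued upwards because \<open>V\<close> has no zero row, and every other vertex is the
  top-left corner of a square whose bottom and right edges are already present. Any finite set of
  the constraints that define the shift space involves a bounded window of the plane, which a
  translate of this quadrant covers; so any finite set of constraints is satisfiable. As there are
  finitely many vertices, Tychonoff's theorem then yields a configuration that satisfies all the
  constraints at once.
\<close>

text \<open>
  The compactness principle behind the passage from windows to the plane: in the product of
  finite discrete spaces, a constraint on two coordinates is a closed condition, and the product
  is compact.
\<close>

lemma binary_constraints_compactness:
  fixes C :: "('i \<times> 'i \<times> 'v::finite rel) set"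
  assumes finsat: "\<And>F. finite F \<Longrightarrow> F \<subseteq> C \<Longrightarrow> \<exists>x. \<forall>(a, b, E)\<in>F. (x a, x b) \<in> E"
  shows "\<exists>x. \<forall>(a, b, E)\<in>C. (x a, x b) \<in> E"
proof -
  let ?T = "product_topology (\<lambda>_::'i. discrete_topology (UNIV :: 'v set)) UNIV"
  define sols where "sols = (\<lambda>(a, b, E). {x :: 'i \<Rightarrow> 'v. (x a, x b) \<in> E})"
  have compact: "compact_space ?T"
    by (simp add: compact_space_product_topology compact_space_discrete_topology)
  have single: "closedin ?T {x. x a = u}" for a :: 'i and u :: 'v
  proof -
    have "continuous_map ?T (discrete_topology UNIV) (\<lambda>x. x a)"
      by (rule continuous_map_product_projection) simp
    then show ?thesis
      using closedin_continuous_map_preimage[of ?T "discrete_topology UNIV" "\<lambda>x. x a" "{u}"]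
      by simp
  qed
  have closed: "closedin ?T (sols c)" for c
  proof -
    obtain a b E where c: "c = (a, b, E)" by (cases c)
    have "sols c = (\<Union>(u, v)\<in>E. {x. x a = u} \<inter> {x. x b = v})"
      by (auto simp: sols_def c)
    moreover have "closedin ?T (\<Union>(u, v)\<in>E. {x. x a = u} \<inter> {x. x b = v})"
      by (intro closedin_Union) (auto intro!: closedin_Int single)
    ultimately show ?thesis by simp
  qed
  have "\<Inter>(sols ` C) \<noteq> {}"
  proof (rule compact[unfolded compact_space_fip, rule_format], intro conjI ballI allI impI)
    show "closedin ?T S" if "S \<in> sols ` C" for S
      using that closed by blast
    show "\<Inter>\<F> \<noteq> {}" if "finite \<F> \<and> \<F> \<subseteq> sols ` C" for \<F>
    proof -
      from that have fin: "finite \<F>" and sub: "\<F> \<subseteq> sols ` C"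
        by blast+
      obtain F where F: "F \<subseteq> C" "finite F" "\<F> = sols ` F"
        using finite_subset_image[OF fin sub] by blast
      then obtain x where "\<forall>(a, b, E)\<in>F. (x a, x b) \<in> E"
        using finsat by blast
      then have "x \<in> \<Inter>\<F>" by (auto simp: F(3) sols_def)
      then show ?thesis by blast
    qed
  qed
  then obtain x where "x \<in> \<Inter>(sols ` C)" by blast
  then show ?thesis by (auto simp: sols_def)
qed

text \<open>
  The quadrant is indexed by the distance \<open>k\<close> to the left of its right-hand column and the
  height \<open>l\<close> above its bottom row, which is why its horizontal edges point from \<open>Suc k\<close> to \<open>k\<close>.
\<close>

lemma quadrant_tiling:
  fixes H V :: "'v rel"
  assumes pred: "\<And>y. \<exists>x. (x, y) \<in> H"
    and succ: "\<And>x. \<exists>y. (x, y) \<in> V"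
    and square: "H O V \<subseteq> V O H"
  shows "\<exists>q :: nat \<Rightarrow> nat \<Rightarrow> 'v.
    \<forall>k l. (q (Suc k) l, q k l) \<in> H \<and> (q k l, q k (Suc l)) \<in> V"
proof -
  obtain left where left: "\<And>y. (left y, y) \<in> H"
    using pred by metis
  obtain up where up: "\<And>x. (x, up x) \<in> V"
    using succ by metis
  have "\<exists>w. (x, w) \<in> V \<and> (w, z) \<in> H" if "(x, z) \<in> H O V" for x z
    using subsetD[OF square that] by blast
  then obtain corner where
    corner: "\<And>x z. (x, z) \<in> H O V \<Longrightarrow> (x, corner x z) \<in> V \<and> (corner x z, z) \<in> H"
    by metis
  \<comment> \<open>One row determines the next: start above its right end and insert corners to the left.\<close>
  define next_row where "next_row r = rec_nat (up (r 0)) (\<lambda>k z. corner (r (Suc k)) z)"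
    for r :: "nat \<Rightarrow> 'v"
  define q where "q k l = (next_row ^^ l) (\<lambda>k. (left ^^ k) undefined) k" for k l
  have next_row: "(r k, next_row r k) \<in> V \<and> (next_row r (Suc k), next_row r k) \<in> H"
    if r: "\<And>k. (r (Suc k), r k) \<in> H" for r k
  proof -
    have V: "(r k, next_row r k) \<in> V" for k
    proof (induction k)
      case 0
      show ?case by (simp add: next_row_def up)
    next
      case (Suc k)
      then show ?case using corner r by (auto simp: next_row_def)
    qed
    have "(next_row r (Suc k), next_row r k) \<in> H"
      using corner[of "r (Suc k)" "next_row r k"] r[of k] V[of k] by (auto simp: next_row_def)
    with V show ?thesis by blast
  qed
  have H: "(q (Suc k) l, q k l) \<in> H" for k l
  proof (induction l arbitrary: k)
    case 0
    show ?case by (simp add: q_def left)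
  next
    case (Suc l)
    then show ?case using next_row[of "\<lambda>k. q k l"] by (simp add: q_def)
  qed
  have "(q k l, q k (Suc l)) \<in> V" for k l
    using next_row[of "\<lambda>k. q k l" k] H by (simp add: q_def)
  with H show ?thesis by blast
qed

lemma plane_tiling:
  fixes H V :: "'v::finite rel"
  assumes "\<And>y. \<exists>x. (x, y) \<in> H"
    and "\<And>x. \<exists>y. (x, y) \<in> V"
    and "H O V \<subseteq> V O H"
  shows "\<exists>x :: int \<times> int \<Rightarrow> 'v.
    \<forall>i j. (x (i, j), x (i + 1, j)) \<in> H \<and> (x (i, j), x (i, j + 1)) \<in> V"
proof -
  obtain q :: "nat \<Rightarrow> nat \<Rightarrow> 'v" where
    qH: "\<And>k l. (q (Suc k) l, q k l) \<in> H" and qV: "\<And>k l. (q k l, q k (Suc l)) \<in> V"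
    using quadrant_tiling[OF assms] by blast
  define C where "C = (\<Union>(i :: int) (j :: int). {((i, j), (i + 1, j), H), ((i, j), (i, j + 1), V)})"
  have "\<exists>x. \<forall>(a, b, E)\<in>C. (x a, x b) \<in> E"
  proof (rule binary_constraints_compactness)
    fix F :: "((int \<times> int) \<times> (int \<times> int) \<times> 'v rel) set"
    assume fin: "finite F" and sub: "F \<subseteq> C"
    define size where "size c = \<bar>fst (fst c)\<bar> + \<bar>snd (fst c)\<bar>"
      for c :: "(int \<times> int) \<times> (int \<times> int) \<times> 'v rel"
    \<comment> \<open>The summand 1 keeps the right end \<open>i + 1\<close> of a horizontal edge inside the quadrant.\<close>
    define N where "N = (\<Sum>c\<in>F. size c) + 1"
    define x where "x = (\<lambda>(i, j). q (nat (N - i)) (nat (j + N)))"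
    have xH: "(x (i, j), x (i + 1, j)) \<in> H" if "i < N" for i j
    proof -
      have "nat (N - i) = Suc (nat (N - (i + 1)))" using that by simp
      then show ?thesis by (simp add: x_def qH)
    qed
    have xV: "(x (i, j), x (i, j + 1)) \<in> V" if "- N \<le> j" for i j
    proof -
      have "nat (j + 1 + N) = Suc (nat (j + N))" using that by simp
      then show ?thesis by (simp add: x_def qV)
    qed
    have "(x a, x b) \<in> E" if c: "(a, b, E) \<in> F" for a b E
    proof -
      obtain i j where a: "a = (i, j)"
        and edge: "b = (i + 1, j) \<and> E = H \<or> b = (i, j + 1) \<and> E = V"
        using sub c by (auto simp: C_def)
      have "size (a, b, E) \<le> (\<Sum>c\<in>F. size c)"
        by (rule member_le_sum) (use c fin in \<open>auto simp: size_def\<close>)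
      then have "i < N" "- N \<le> j" by (auto simp: N_def size_def a)
      with edge xH xV show ?thesis by (auto simp: a)
    qed
    then show "\<exists>x. \<forall>(a, b, E)\<in>F. (x a, x b) \<in> E" by blast
  qed
  then obtain x where x: "\<And>a b E. (a, b, E) \<in> C \<Longrightarrow> (x a, x b) \<in> E"
    by fast
  have "((i, j), (i + 1, j), H) \<in> C" "((i, j), (i, j + 1), V) \<in> C" for i j
    by (auto simp: C_def)
  with x show ?thesis by blast
qed

lemma row_adjacency_matrix_nonzero_iff:
  "row i (adjacency_matrix E) \<noteq> 0 \<longleftrightarrow> (\<exists>j. (i, j) \<in> E)"
  by (auto simp: adjacency_matrix_def row_def vec_eq_iff)

lemma column_adjacency_matrix_nonzero_iff:
  "column j (adjacency_matrix E) \<noteq> 0 \<longleftrightarrow> (\<exists>i. (i, j) \<in> E)"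
  by (auto simp: adjacency_matrix_def column_def vec_eq_iff)

text \<open>
  An entry of the product counts the paths of length two, so there is no cancellation and its
  support is the relational composition.
\<close>

lemma adjacency_matrix_mult_nonzero_iff:
  "(adjacency_matrix E ** adjacency_matrix F) $ i $ j \<noteq> 0 \<longleftrightarrow> (i, j) \<in> E O F"
proof -
  have "(adjacency_matrix E ** adjacency_matrix F) $ i $ j = 0 \<longleftrightarrow>
    (\<forall>k. adjacency_matrix E $ i $ k * adjacency_matrix F $ k $ j = 0)"
    unfolding matrix_matrix_mult_def
    by (simp add: sum_nonneg_eq_0_iff adjacency_matrix_def)
  then show ?thesis by (auto simp: adjacency_matrix_def)
qed

theorem corollary6:
  fixes H V :: "'v::finite rel"
  assumes "\<And>i. row i (adjacency_matrix H) \<noteq> 0"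
    and "\<And>j. column j (adjacency_matrix H) \<noteq> 0"
    and "\<And>i. row i (adjacency_matrix V) \<noteq> 0"
    and "\<And>j. column j (adjacency_matrix V) \<noteq> 0"
    and "\<And>i j. (adjacency_matrix H ** adjacency_matrix V) $ i $ j \<noteq> 0 \<Longrightarrow>
                (adjacency_matrix V ** adjacency_matrix H) $ i $ j \<noteq> 0"
  shows "shift_space (H, V) \<noteq> {}"
proof -
  have "H O V \<subseteq> V O H"
    using assms(5) unfolding adjacency_matrix_mult_nonzero_iff by auto
  then obtain x :: "int \<times> int \<Rightarrow> 'v" where
    "\<forall>i j. (x (i, j), x (i + 1, j)) \<in> H \<and> (x (i, j), x (i, j + 1)) \<in> V"
    using plane_tiling[of H V] assms(2,3)
    unfolding row_adjacency_matrix_nonzero_iff column_adjacency_matrix_nonzero_iff by blast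
  then have "x \<in> shift_space (H, V)"
    by (simp add: shift_space_def adjacency_matrix_def)
  then show ?thesis by blast
qed

end
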